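(* Let $A,B,B',C,C'\in\widehat{\mathbb{F}_q}$ and $x,y\in\mathbb{F}_q$. If $x\neq 1$, then $$F_{2}(A;B,B';C,C';x,y)=C(-1)\,\overline{A}(1-x)\,F_{2}\left(A;\overline{B}C,B';C,C';-\frac{x}{1-x},\frac{y}{1-x}\right).$$ If $y\neq 1$, then $$F_{2}(A;B,B';C,C';x,y)=C'(-1)\,\overline{A}(1-y)\,F_{2}\left(A;B,\overline{B'}C';C,C';\frac{x}{1-y},-\frac{y}{1-y}\right).$$ If $x+y\neq 1$, then $$F_{2}(A;B,B';C,C';x,y)=CC'(-1)\,\overline{A}(1-x-y)\,F_{2}\left(A;\overline{B}C,\overline{B'}C';C,C';-\frac{x}{1-x-y},-\frac{y}{1-x-y}\right).$$
   Context: Let $q$ be a power of a prime, $\mathbb{F}_q$ the field with $q$ elements, and $\widehat{\mathbb{F}_q}$ the group of (complex-valued) multiplicative characters of $\mathbb{F}_q^*$. Every character $\chi$, including the trivial character $\varepsilon$, is extended to $\mathbb{F}_q$ by $\chi(0)=0$. $\overline{\chi}$ denotes the inverse of $\chi$. Products of characters are evaluated pointwise, e.g. $CC'(-1)=C(-1)C'(-1)$. The finite field Appell series $F_2$ is defined, for $A,B,B',C,C'\in\widehat{\mathbb{F}_q}$ and $x,y\in\mathbb{F}_q$, by $$F_{2}(A;B,B';C,C';x,y)=\varepsilon(xy)\,BB'CC'(-1)\sum_{u,v\in\mathbb{F}_q}B(u)B'(v)\,\overline{B}C(1-u)\,\overline{B'}C'(1-v)\,\overline{A}(1-ux-vy).$$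 *)

theory Defs
  imports Complex_Main
begin

text \<open>
  The field \<open>\<F>\<^sub>q\<close> is an arbitrary type \<open>'a\<close> of classes \<open>field\<close> and \<open>finite\<close>.
  A multiplicative character is a homomorphism from the nonzero elements to the nonzero complex
  numbers, represented by its extension by 0 to all of \<open>'a\<close>. Since the extension is
  total, equality of characters is equality of functions.
\<close>

definition mult_char :: "('a::field \<Rightarrow> complex) \<Rightarrow> bool" where
  "mult_char \<chi> \<longleftrightarrow> \<chi> 0 = 0 \<and> (\<forall>x. x \<noteq> 0 \<longrightarrow> \<chi> x \<noteq> 0) \<and>
     (\<forall>x y. x \<noteq> 0 \<longrightarrow> y \<noteq> 0 \<longrightarrow> \<chi> (x * y) = \<chi> x * \<chi> y)"

definition triv_char :: "'a::field \<Rightarrow> complex" where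
  "triv_char x = (if x = 0 then 0 else 1)"

definition char_mult :: "('a::field \<Rightarrow> complex) \<Rightarrow> ('a \<Rightarrow> complex) \<Rightarrow> 'a \<Rightarrow> complex" where
  "char_mult \<chi> \<psi> x = \<chi> x * \<psi> x"

text \<open>As \<open>inverse 0 = 0\<close>, the pointwise inverse also respects the convention \<open>\<chi> 0 = 0\<close>.\<close>

definition char_inv :: "('a::field \<Rightarrow> complex) \<Rightarrow> 'a \<Rightarrow> complex" where
  "char_inv \<chi> x = inverse (\<chi> x)"

lemma mult_char_triv_char: "mult_char triv_char"
  by (simp add: mult_char_def triv_char_def)

lemma mult_char_char_mult: "mult_char \<chi> \<Longrightarrow> mult_char \<psi> \<Longrightarrow> mult_char (char_mult \<chi> \<psi>)"
  by (simp add: mult_char_def char_mult_def)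

lemma mult_char_char_inv: "mult_char \<chi> \<Longrightarrow> mult_char (char_inv \<chi>)"
  by (simp add: mult_char_def char_inv_def)

lemma char_mult_triv_char: "mult_char \<chi> \<Longrightarrow> char_mult triv_char \<chi> = \<chi>"
  by (auto simp: mult_char_def char_mult_def triv_char_def)

lemma char_mult_char_inv: "mult_char \<chi> \<Longrightarrow> char_mult (char_inv \<chi>) \<chi> = triv_char"
  by (auto simp: mult_char_def char_mult_def char_inv_def triv_char_def)

text \<open>The arguments of \<open>appell_F2\<close> are \<open>A; B, B'; C, C'; x, y\<close>, in this order.\<close>

definition appell_F2 ::
  "('a::{field,finite} \<Rightarrow> complex) \<Rightarrow> ('a \<Rightarrow> complex) \<Rightarrow> ('a \<Rightarrow> complex) \<Rightarrow>
   ('a \<Rightarrow> complex) \<Rightarrow> ('a \<Rightarrow> complex) \<Rightarrow> 'a \<Rightarrow> 'a \<Rightarrow> complex" where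
  "appell_F2 A B B' C C' x y =
     triv_char (x * y) * char_mult (char_mult (char_mult B B') C) C' (-1) *
     (\<Sum>u\<in>UNIV. \<Sum>v\<in>UNIV.
        B u * B' v * char_mult (char_inv B) C (1 - u) * char_mult (char_inv B') C' (1 - v) *
        char_inv A (1 - u * x - v * y))"

end

theory Submission imports Defs begin

text \<open>
  Substitute \<open>u \<mapsto> 1 - u\<close> (and/or \<open>v \<mapsto> 1 - v\<close>) in the defining sum. This interchanges \<open>B\<close> with
  \<open>B\<^sup>-\<^sup>1 C\<close> and turns \<open>1 - u x - v y\<close> into an expression with constant term \<open>d = 1 - x\<close>
  (or \<open>1 - y\<close>, \<open>1 - x - y\<close>); when \<open>d \<noteq> 0\<close>, the factor \<open>A\<^sup>-\<^sup>1(d)\<close> can be pulled out of the sum.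
\<close>

lemma mult_char_mult:
  assumes "mult_char \<chi>"
  shows "\<chi> (x * y) = \<chi> x * \<chi> y"
  using assms by (cases "x = 0"; cases "y = 0") (auto simp: mult_char_def)

text \<open>\<open>\<chi> 1\<close> is a nonzero idempotent, hence 1. Values at -1 are therefore
  their own inverses and cancel in pairs in the prefactors.\<close>

lemma mult_char_minus_one_sq:
  assumes "mult_char \<chi>"
  shows "\<chi> (-1) * \<chi> (-1) = 1"
proof -
  have "\<chi> 1 = \<chi> 1 * \<chi> 1" "\<chi> 1 \<noteq> 0"
    using assms mult_char_mult[OF assms, of 1 1] by (auto simp: mult_char_def)
  then show ?thesis
    using mult_char_mult[OF assms, of "-1" "-1"] by simp
qed

lemma inverse_mult_char_minus_one:
  assumes "mult_char \<chi>"
  shows "inverse (\<chi> (-1)) = \<chi> (-1)"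
  using mult_char_minus_one_sq[OF assms] by (rule inverse_unique)

text \<open>The passage from \<open>B\<close> to its inverse times \<open>C\<close> is an
  involution, so the series with the new parameter carries \<open>B (1 - u)\<close> as its
  complementary factor.\<close>

lemma char_inv_quotient_mult:
  assumes "mult_char B" and "mult_char C"
  shows "char_mult (char_inv (char_mult (char_inv B) C)) C = B"
proof
  show "char_mult (char_inv (char_mult (char_inv B) C)) C x = B x" for x
    using assms by (cases "x = 0") (simp_all add: mult_char_def char_mult_def char_inv_def)
qed

text \<open>Giving the product as an equation lets an affine identity in \<open>u\<close> and
  \<open>v\<close> become a rewrite rule for the summand.\<close>

lemma char_inv_scale:
  assumes "mult_char A" and "d * r = (s :: 'a::field)"
  shows "char_inv A s = char_inv A d * char_inv A r"
  using assms by (metis mult_char_char_inv mult_char_mult)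

lemma triv_char_eq_iff: "triv_char x = triv_char y \<longleftrightarrow> (x = 0 \<longleftrightarrow> y = 0)"
  by (simp add: triv_char_def)

lemma sum_UNIV_reflect: "(\<Sum>u\<in>UNIV. f u) = (\<Sum>u\<in>UNIV. f (c - u))"
  for c :: "'a::{ab_group_add,finite}"
  by (rule sum.reindex_bij_witness[of _ "\<lambda>u. c - u" "\<lambda>u. c - u"]) auto

text \<open>Interchanging the two summations gives this symmetry, which reduces reflection in
  \<open>v\<close> to reflection in \<open>u\<close>.\<close>

lemma appell_F2_swap: "appell_F2 A B B' C C' x y = appell_F2 A B' B C' C y x"
  unfolding appell_F2_def
  by (subst sum.swap) (simp add: char_mult_def algebra_simps)

lemma appell_F2_reflect_left:
  fixes x y :: "'a::{field,finite}"
  assumes A: "mult_char A" and B: "mult_char B" and C: "mult_char C" and "x \<noteq> 1"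
  shows "appell_F2 A B B' C C' x y =
    C (-1) * char_inv A (1 - x) *
    appell_F2 A (char_mult (char_inv B) C) B' C C' (- (x / (1 - x))) (y / (1 - x))"
proof -
  define D where "D = char_mult (char_inv B) C"
  define E where "E = char_mult (char_inv B') C'"
  define x' where "x' = - (x / (1 - x))"
  define y' where "y' = y / (1 - x)"
  have DC: "char_mult (char_inv D) C = B"
    unfolding D_def using B C by (rule char_inv_quotient_mult)
  \<comment> \<open>Replacing \<open>B\<close> by \<open>D\<close> introduces one extra sign
    \<open>C (-1)\<close>; the prefactor of the claim cancels it.\<close>
  have sgn: "C (-1) * char_mult (char_mult (char_mult D B') C) C' (-1)
      = char_mult (char_mult (char_mult B B') C) C' (-1)"
    using mult_char_minus_one_sq[OF C]
    by (simp add: D_def char_mult_def char_inv_def inverse_mult_char_minus_one[OF B])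
  have triv: "triv_char (x' * y') = (triv_char (x * y) :: complex)"
    using \<open>x \<noteq> 1\<close> by (simp add: triv_char_eq_iff x'_def y'_def)
  have "(1 - x) * x' = - x" "(1 - x) * y' = y"
    using \<open>x \<noteq> 1\<close> by (simp_all add: x'_def y'_def)
  \<comment> \<open>The new arguments \<open>x'\<close> and \<open>y'\<close> are chosen so that the
    reflected linear form is its constant term times a form of the original shape.\<close>
  then have "(1 - x) * (1 - u * x' - v * y') = 1 - (1 - u) * x - v * y" for u v
    by algebra
  note scale = char_inv_scale[OF A this]
  have "(\<Sum>u\<in>UNIV. \<Sum>v\<in>UNIV. B u * B' v * D (1 - u) * E (1 - v) * char_inv A (1 - u * x - v * y))
      = (\<Sum>u\<in>UNIV. \<Sum>v\<in>UNIV. B (1 - u) * B' v * D u * E (1 - v) *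
           char_inv A (1 - (1 - u) * x - v * y))"
    by (subst sum_UNIV_reflect[where c = 1]) simp
  also have "\<dots> = char_inv A (1 - x) * (\<Sum>u\<in>UNIV. \<Sum>v\<in>UNIV. D u * B' v * B (1 - u) * E (1 - v) *
           char_inv A (1 - u * x' - v * y'))"
    unfolding scale sum_distrib_left by (simp only: ac_simps)
  finally show ?thesis
    unfolding appell_F2_def D_def[symmetric] E_def[symmetric] x'_def[symmetric] y'_def[symmetric]
      DC triv sgn[symmetric]
    by simp
qed

text \<open>Composing two one-variable reflections would divide by \<open>1 - x\<close> or
  \<open>1 - y\<close> on the way, which fails at \<open>x = y = 1\<close>. Reflecting both
  variables at once divides only by \<open>1 - x - y\<close>.\<close>

lemma appell_F2_reflect_both:
  fixes x y :: "'a::{field,finite}"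
  assumes A: "mult_char A" and B: "mult_char B" and B': "mult_char B'"
    and C: "mult_char C" and C': "mult_char C'" and "x + y \<noteq> 1"
  shows "appell_F2 A B B' C C' x y =
    char_mult C C' (-1) * char_inv A (1 - x - y) *
    appell_F2 A (char_mult (char_inv B) C) (char_mult (char_inv B') C') C C'
      (- (x / (1 - x - y))) (- (y / (1 - x - y)))"
proof -
  define D where "D = char_mult (char_inv B) C"
  define E where "E = char_mult (char_inv B') C'"
  define x' where "x' = - (x / (1 - x - y))"
  define y' where "y' = - (y / (1 - x - y))"
  have nz: "1 - x - y \<noteq> 0"
    using \<open>x + y \<noteq> 1\<close> by (simp add: algebra_simps)
  have DC: "char_mult (char_inv D) C = B" and EC: "char_mult (char_inv E) C' = B'"
    unfolding D_def E_def using B C B' C' by (simp_all only: char_inv_quotient_mult)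
  have sgn: "char_mult C C' (-1) * char_mult (char_mult (char_mult D E) C) C' (-1)
      = char_mult (char_mult (char_mult B B') C) C' (-1)"
  proof -
    have "char_mult C C' (-1) * char_mult (char_mult (char_mult D E) C) C' (-1)
        = (C (-1) * C (-1)) * (C' (-1) * C' (-1)) *
          char_mult (char_mult (char_mult B B') C) C' (-1)"
      by (simp only: D_def E_def char_mult_def char_inv_def ac_simps
          inverse_mult_char_minus_one[OF B] inverse_mult_char_minus_one[OF B'])
    then show ?thesis
      by (simp only: mult_char_minus_one_sq[OF C] mult_char_minus_one_sq[OF C'] mult_1_left)
  qed
  have triv: "triv_char (x' * y') = (triv_char (x * y) :: complex)"
    using nz by (simp add: triv_char_eq_iff x'_def y'_def)
  have "(1 - x - y) * x' = - x" "(1 - x - y) * y' = - y"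
    using nz by (simp_all add: x'_def y'_def)
  then have "(1 - x - y) * (1 - u * x' - v * y') = 1 - (1 - u) * x - (1 - v) * y" for u v
    by algebra
  note scale = char_inv_scale[OF A this]
  have "(\<Sum>u\<in>UNIV. \<Sum>v\<in>UNIV. B u * B' v * D (1 - u) * E (1 - v) * char_inv A (1 - u * x - v * y))
      = (\<Sum>u\<in>UNIV. \<Sum>v\<in>UNIV. B (1 - u) * B' v * D u * E (1 - v) *
           char_inv A (1 - (1 - u) * x - v * y))"
    by (subst sum_UNIV_reflect[where c = 1]) simp
  also have "\<dots> = (\<Sum>u\<in>UNIV. \<Sum>v\<in>UNIV. B (1 - u) * B' (1 - v) * D u * E v *
           char_inv A (1 - (1 - u) * x - (1 - v) * y))"
    \<comment> \<open>The outer sum is already reflected; for each fixed \<open>u\<close> the inner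
      sum over \<open>v\<close> is reflected in turn.\<close>
    by (rule sum.cong[OF refl], subst sum_UNIV_reflect[where c = 1]) simp
  also have "\<dots> = char_inv A (1 - x - y) * (\<Sum>u\<in>UNIV. \<Sum>v\<in>UNIV. D u * E v * B (1 - u) * B' (1 - v) *
           char_inv A (1 - u * x' - v * y'))"
    unfolding scale sum_distrib_left by (simp only: ac_simps)
  finally show ?thesis
    unfolding appell_F2_def D_def[symmetric] E_def[symmetric] x'_def[symmetric] y'_def[symmetric]
      DC EC triv sgn[symmetric]
    by simp
qed

theorem theorem3p4:
  fixes A B B' C C' :: "'a::{field,finite} \<Rightarrow> complex" and x y :: 'a
  assumes "mult_char A" and "mult_char B" and "mult_char B'"
    and "mult_char C" and "mult_char C'"
  shows "(x \<noteq> 1 \<longrightarrow>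
            appell_F2 A B B' C C' x y =
              C (-1) * char_inv A (1 - x) *
              appell_F2 A (char_mult (char_inv B) C) B' C C' (- (x / (1 - x))) (y / (1 - x))) \<and>
         (y \<noteq> 1 \<longrightarrow>
            appell_F2 A B B' C C' x y =
              C' (-1) * char_inv A (1 - y) *
              appell_F2 A B (char_mult (char_inv B') C') C C' (x / (1 - y)) (- (y / (1 - y)))) \<and>
         (x + y \<noteq> 1 \<longrightarrow>
            appell_F2 A B B' C C' x y =
              char_mult C C' (-1) * char_inv A (1 - x - y) *
              appell_F2 A (char_mult (char_inv B) C) (char_mult (char_inv B') C') C C'
                (- (x / (1 - x - y))) (- (y / (1 - x - y))))"
proof (intro conjI impI)
  assume "y \<noteq> 1"
  then show "appell_F2 A B B' C C' x y =
      C' (-1) * char_inv A (1 - y) *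
      appell_F2 A B (char_mult (char_inv B') C') C C' (x / (1 - y)) (- (y / (1 - y)))"
    using appell_F2_reflect_left[of A B' C' y B C x] assms
    \<comment> \<open>Fixing \<open>B\<close> in the first slot makes the symmetry a terminating
      rewrite rule: it moves \<open>B\<close> to the second slot on both sides, matching the
      reflection with the roles of the variables exchanged.\<close>
    by (simp only: appell_F2_swap[of A B] not_False_eq_True simp_thms)
qed (use assms in \<open>simp_all only: appell_F2_reflect_left appell_F2_reflect_both simp_thms\<close>)

end
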